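(* Consider the model in which the response mechanism is $\operatorname{logit}\{P(\delta=1\mid \boldsymbol{x},y;\boldsymbol{\alpha},\beta)\}=h(\boldsymbol{x};\boldsymbol{\alpha})+\beta y$, and the conditional distribution $[y\mid\boldsymbol{x},\delta=1]$ has the mixture density $$f(y\mid\boldsymbol{x},\delta=1;\boldsymbol{\gamma})=\sum_{k=1}^{K}\pi_k\exp\left[\tau_k\{y\theta_k-b(\theta_k)\}+c(y;\tau_k)\right],\qquad \theta_k=\theta\Big(\sum_{l=0}^{m(k)}\eta_{lk}(\boldsymbol{x})\kappa_{lk}\Big),$$ and suppose that the family of distributions $[y\mid\boldsymbol{x},\delta=1]$ is identifiable (that is, equality of $f(y\mid\boldsymbol{x},\delta=1;\boldsymbol{\gamma})$ and $f(y\mid\boldsymbol{x},\delta=1;\boldsymbol{\gamma}')$ with probability one implies $\boldsymbol{\gamma}=\boldsymbol{\gamma}'$). Define $$g(\boldsymbol{\alpha},\beta,\boldsymbol{\gamma})=h(\boldsymbol{x};\boldsymbol{\alpha})-\log\left[\sum_{k=1}^{K}\pi_k\exp\left\{-\tau_k b(\theta_k)+\tau_k b\Big(\theta_k-\frac{\beta}{\tau_k}\Big)\right\}\right],$$ regarded as a function of $\boldsymbol{x}$. Then the model is identifiable if and only if, for all parameter values $\boldsymbol{\alpha},\boldsymbol{\alpha}',\beta,\beta',\boldsymbol{\gamma}$, $$g(\boldsymbol{\alpha},\beta,\boldsymbol{\gamma})=g(\boldsymbol{\alpha}',\beta',\boldsymbol{\gamma})\ \Rightarrow\ \beta=\beta',$$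 where the equality on the left is equality as functions of $\boldsymbol{x}$, with probability one under the distribution of $\boldsymbol{x}$.
   Context: $(\boldsymbol{x},y,\delta)$ are random variables: $\boldsymbol{x}$ is a fully observed covariate vector, $y$ is a real outcome subject to missingness, and $\delta\in\{0,1\}$ is the response indicator ($\delta=1$ iff $y$ is observed). $\operatorname{logit}(z)=\log\{z/(1-z)\}$ for $0<z<1$. The function $h(\boldsymbol{x};\boldsymbol{\alpha})$ is known up to the finite-dimensional parameter $\boldsymbol{\alpha}$ and is injective in $\boldsymbol{\alpha}$: if $h(\boldsymbol{x};\boldsymbol{\alpha})=h(\boldsymbol{x};\boldsymbol{\alpha}')$ with probability one in $\boldsymbol{x}$, then $\boldsymbol{\alpha}=\boldsymbol{\alpha}'$. The parameters $\boldsymbol{\alpha}$, $\beta\in\mathbb{R}$, $\boldsymbol{\gamma}$ range over a product parameter space. Here $\boldsymbol{\gamma}$ collects all of $\kappa_{lk}$ ($0\le l\le m(k)$, $1\le k\le K$), $\tau_1,\ldots,\tau_K>0$, the mixing proportions $\pi_k\ge 0$ with $\sum_{k=1}^K\pi_k=1$, and the number of components $K$. The functions $b$, $c$, $\theta(\cdot)$ and $\eta_{lk}$ are known. Densities of $y$ are with respect to a fixed dominating measure $dy$ (e.g. Lebesgue or counting measure), and $b$ is the normalizing function: $\int\exp\{\tau y t+c(y;\tau)\}\,dy=\exp\{\tau b(t)\}$ for all relevant $t$, including $t=\theta_k-\beta/\tau_k$ with $\tau=\tau_k$ (so $\int e^{-\beta y}f(y\mid\boldsymbol{x},\delta=1;\boldsymbol{\gamma})\,dy<\infty$).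 The density $f(y\mid\boldsymbol{x};\boldsymbol{\alpha},\beta,\boldsymbol{\gamma})$ of $[y\mid\boldsymbol{x}]$ is the one determined by the response mechanism and the respondents' density through Bayes' theorem: $$P(\delta=1\mid\boldsymbol{x},y;\boldsymbol{\alpha},\beta)f(y\mid\boldsymbol{x};\boldsymbol{\alpha},\beta,\boldsymbol{\gamma})=\frac{f(y\mid\boldsymbol{x},\delta=1;\boldsymbol{\gamma})}{\int f(u\mid\boldsymbol{x},\delta=1;\boldsymbol{\gamma})\{P(\delta=1\mid\boldsymbol{x},u;\boldsymbol{\alpha},\beta)\}^{-1}\,du}.$$ The model is called identifiable if $$P(\delta=1\mid\boldsymbol{x},y;\boldsymbol{\alpha},\beta)f(y\mid\boldsymbol{x};\boldsymbol{\alpha},\beta,\boldsymbol{\gamma})=P(\delta=1\mid\boldsymbol{x},y;\boldsymbol{\alpha}',\beta')f(y\mid\boldsymbol{x};\boldsymbol{\alpha}',\beta',\boldsymbol{\gamma}')$$ with probability one (for almost every $\boldsymbol{x}$ under its distribution and almost every $y$) implies $(\boldsymbol{\alpha},\beta,\boldsymbol{\gamma})=(\boldsymbol{\alpha}',\beta',\boldsymbol{\gamma}')$. *)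

theory Defs
  imports "HOL-Probability.Probability"
begin

definition logit :: "real \<Rightarrow> real" where
  "logit z = ln (z / (1 - z))"

text \<open>
  The parameter \<open>\<gamma>\<close> of a finite mixture: the number of components \<open>K\<close>, and for each component
  \<open>k = 1, \<dots>, K\<close> the coefficients \<open>\<kappa>\<^sub>l\<^sub>k\<close> (here \<open>coef \<gamma> k l\<close>), the precision \<open>\<tau>\<^sub>k\<close>
  and the mixing proportion \<open>\<pi>\<^sub>k\<close>.
\<close>

datatype mix_param =
  Mix_Param (ncomp: nat) (coef: "nat \<Rightarrow> nat \<Rightarrow> real") (prec: "nat \<Rightarrow> real") (weight: "nat \<Rightarrow> real")

text \<open>
  The extensional function spaces fix the values of the coordinate functions outside their index
  sets, so that equality of two elements of \<open>mix_params m\<close> is equality of \<open>K\<close> and of all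
  \<open>\<kappa>\<^sub>l\<^sub>k\<close>, \<open>\<tau>\<^sub>k\<close>, \<open>\<pi>\<^sub>k\<close>.
\<close>

definition mix_params :: "(nat \<Rightarrow> nat) \<Rightarrow> mix_param set" where
  "mix_params m = {\<gamma>.
     coef \<gamma> \<in> (\<Pi>\<^sub>E k\<in>{1..ncomp \<gamma>}. {0..m k} \<rightarrow>\<^sub>E UNIV) \<and>
     prec \<gamma> \<in> {1..ncomp \<gamma>} \<rightarrow>\<^sub>E {0<..} \<and>
     weight \<gamma> \<in> {1..ncomp \<gamma>} \<rightarrow>\<^sub>E {0..} \<and>
     (\<Sum>k=1..ncomp \<gamma>. weight \<gamma> k) = 1}"

definition comp_theta ::
  "(real \<Rightarrow> real) \<Rightarrow> (nat \<Rightarrow> nat \<Rightarrow> 'x \<Rightarrow> real) \<Rightarrow> (nat \<Rightarrow> nat) \<Rightarrow> mix_param \<Rightarrow> nat \<Rightarrow> 'x \<Rightarrow> real" where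
  "comp_theta \<theta> \<eta> m \<gamma> k x = \<theta> (\<Sum>l=0..m k. \<eta> l k x * coef \<gamma> k l)"

definition mix_density ::
  "(real \<Rightarrow> real) \<Rightarrow> (real \<Rightarrow> real \<Rightarrow> real) \<Rightarrow> (real \<Rightarrow> real) \<Rightarrow> (nat \<Rightarrow> nat \<Rightarrow> 'x \<Rightarrow> real) \<Rightarrow>
   (nat \<Rightarrow> nat) \<Rightarrow> mix_param \<Rightarrow> 'x \<Rightarrow> real \<Rightarrow> real" where
  "mix_density b c \<theta> \<eta> m \<gamma> x y =
     (\<Sum>k=1..ncomp \<gamma>. weight \<gamma> k *
        exp (prec \<gamma> k * (y * comp_theta \<theta> \<eta> m \<gamma> k x - b (comp_theta \<theta> \<eta> m \<gamma> k x)) + c y (prec \<gamma> k)))"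

definition g_fun ::
  "('x \<Rightarrow> 'a \<Rightarrow> real) \<Rightarrow> (real \<Rightarrow> real) \<Rightarrow> (real \<Rightarrow> real) \<Rightarrow> (nat \<Rightarrow> nat \<Rightarrow> 'x \<Rightarrow> real) \<Rightarrow>
   (nat \<Rightarrow> nat) \<Rightarrow> 'a \<Rightarrow> real \<Rightarrow> mix_param \<Rightarrow> 'x \<Rightarrow> real" where
  "g_fun h b \<theta> \<eta> m \<alpha> \<beta> \<gamma> x =
     h x \<alpha> - ln (\<Sum>k=1..ncomp \<gamma>. weight \<gamma> k *
        exp (- prec \<gamma> k * b (comp_theta \<theta> \<eta> m \<gamma> k x)
             + prec \<gamma> k * b (comp_theta \<theta> \<eta> m \<gamma> k x - \<beta> / prec \<gamma> k)))"

text \<open>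
  Identifiability of a family of functions of \<open>(x, y)\<close> indexed by a parameter set \<open>\<Theta>\<close>, where
  \<open>PX\<close> is the distribution of \<open>x\<close> and \<open>dy\<close> the dominating measure for \<open>y\<close>.
\<close>

definition identifiable ::
  "'x measure \<Rightarrow> real measure \<Rightarrow> 't set \<Rightarrow> ('t \<Rightarrow> 'x \<Rightarrow> real \<Rightarrow> real) \<Rightarrow> bool" where
  "identifiable PX dy \<Theta> q \<longleftrightarrow>
     (\<forall>s\<in>\<Theta>. \<forall>t\<in>\<Theta>. (AE x in PX. AE y in dy. q s x y = q t x y) \<longrightarrow> s = t)"

end

theory Submission
  imports Defs
begin

text \<open>
  By the logistic form of the response mechanism, \<open>1 / P = 1 + exp (- h) * exp (- \<beta> * y)\<close>, and
  exponential tilting maps each mixture component to a component of the same family, so the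
  denominator in Bayes' formula equals \<open>1 + exp (- g)\<close>. Hence the observed-data likelihood is the
  respondents' density divided by \<open>1 + exp (- g)\<close>. Integrating over \<open>y\<close> recovers \<open>g\<close> from it, and
  then the respondents' density, and with that \<open>\<gamma>\<close>. What remains is whether \<open>g\<close> determines
  \<open>(\<alpha>, \<beta>)\<close> for fixed \<open>\<gamma>\<close>; once \<open>\<beta>\<close> is known, it determines \<open>h\<close> and hence \<open>\<alpha>\<close>.
\<close>

lemma inverse_eq_if_logit_eq:
  assumes "0 < p" "p < 1" "logit p = z"
  shows "inverse p = 1 + exp (- z)"
proof -
  have "exp z = p / (1 - p)"
    using assms by (auto simp: logit_def)
  then show ?thesis
    using assms by (simp add: exp_minus field_simps)
qed

text \<open>Multiplying component \<open>k\<close> by \<open>exp (- \<beta> * y)\<close> moves its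
  natural parameter from \<theta>_k to \<theta>_k - \<beta> / \<tau>_k and leaves \<open>c\<close>
  unchanged, so the normalizing property at the shifted point gives the integral. The resulting sum
  is the moment generating function of the respondents' density at -\<beta>, and also the argument
  of \<open>ln\<close> in \<open>g_fun\<close>.\<close>

lemma has_bochner_integral_mix_density_tilt:
  assumes "\<And>k. k \<in> {1..ncomp \<gamma>} \<Longrightarrow> 0 < prec \<gamma> k"
    and "\<And>k. k \<in> {1..ncomp \<gamma>} \<Longrightarrow> has_bochner_integral dy
      (\<lambda>y. exp (prec \<gamma> k * y * (comp_theta \<theta> \<eta> m \<gamma> k x - \<beta> / prec \<gamma> k) + c y (prec \<gamma> k)))
      (exp (prec \<gamma> k * b (comp_theta \<theta> \<eta> m \<gamma> k x - \<beta> / prec \<gamma> k)))"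
  shows "has_bochner_integral dy (\<lambda>y. mix_density b c \<theta> \<eta> m \<gamma> x y * exp (- \<beta> * y))
    (\<Sum>k=1..ncomp \<gamma>. weight \<gamma> k * exp (- prec \<gamma> k * b (comp_theta \<theta> \<eta> m \<gamma> k x)
       + prec \<gamma> k * b (comp_theta \<theta> \<eta> m \<gamma> k x - \<beta> / prec \<gamma> k)))"
proof -
  let ?t = "\<lambda>k. comp_theta \<theta> \<eta> m \<gamma> k x"
  \<comment> \<open>The factor \<open>exp (- prec \<gamma> k * b (?t k))\<close> is free of
    \<open>y\<close>; pulling it out leaves the kernel whose integral is assumed.\<close>
  have "has_bochner_integral dy
      (\<lambda>y. \<Sum>k=1..ncomp \<gamma>. (weight \<gamma> k * exp (- prec \<gamma> k * b (?t k))) *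
         exp (prec \<gamma> k * y * (?t k - \<beta> / prec \<gamma> k) + c y (prec \<gamma> k)))
      (\<Sum>k=1..ncomp \<gamma>. (weight \<gamma> k * exp (- prec \<gamma> k * b (?t k))) *
         exp (prec \<gamma> k * b (?t k - \<beta> / prec \<gamma> k)))"
    using assms(2) by (intro has_bochner_integral_sum has_bochner_integral_mult_right) auto
  moreover have "(\<Sum>k=1..ncomp \<gamma>. (weight \<gamma> k * exp (- prec \<gamma> k * b (?t k))) *
         exp (prec \<gamma> k * y * (?t k - \<beta> / prec \<gamma> k) + c y (prec \<gamma> k)))
      = mix_density b c \<theta> \<eta> m \<gamma> x y * exp (- \<beta> * y)" for y
    unfolding mix_density_def sum_distrib_right
  proof (rule sum.cong)
    fix k assume "k \<in> {1..ncomp \<gamma>}"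
    \<comment> \<open>Needed for \<tau>_k * (\<beta> / \<tau>_k) = \<beta>, which makes the tilt the
      same in every component.\<close>
    then have "prec \<gamma> k \<noteq> 0"
      using assms(1) by force
    then have "prec \<gamma> k * y * (?t k - \<beta> / prec \<gamma> k) = prec \<gamma> k * y * ?t k - \<beta> * y"
      by (simp add: field_simps)
    then show "(weight \<gamma> k * exp (- prec \<gamma> k * b (?t k))) *
         exp (prec \<gamma> k * y * (?t k - \<beta> / prec \<gamma> k) + c y (prec \<gamma> k)) =
       weight \<gamma> k * exp (prec \<gamma> k * (y * ?t k - b (?t k)) + c y (prec \<gamma> k)) * exp (- \<beta> * y)"
      by (simp add: mult.assoc exp_add [symmetric]) (simp add: algebra_simps)
  qed simp
  ultimately show ?thesis
    by (simp only: exp_add mult.assoc)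
qed

text \<open>Single weights may vanish, but weights with sum one cannot all do so, and one nonzero
  weight already makes the sum positive. This places the argument of \<open>ln\<close> in
  \<open>g_fun\<close> where \<open>exp\<close> inverts \<open>ln\<close>.\<close>

lemma mix_params_weighted_sum_pos:
  fixes a :: "nat \<Rightarrow> real"
  assumes "\<gamma> \<in> mix_params m" and "\<And>k. 0 < a k"
  shows "0 < (\<Sum>k=1..ncomp \<gamma>. weight \<gamma> k * a k)"
proof -
  have nonneg: "\<And>k. k \<in> {1..ncomp \<gamma>} \<Longrightarrow> 0 \<le> weight \<gamma> k"
    and one: "(\<Sum>k=1..ncomp \<gamma>. weight \<gamma> k) = 1"
    using assms(1) by (auto simp: mix_params_def PiE_iff)
  obtain k where k: "k \<in> {1..ncomp \<gamma>}" "weight \<gamma> k \<noteq> 0"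
    using one by (metis sum.neutral zero_neq_one)
  then have "0 < weight \<gamma> k * a k"
    using nonneg assms(2) by (simp add: less_le)
  then show ?thesis
    using k nonneg assms(2) by (intro sum_pos2[of _ k]) (auto simp: less_imp_le)
qed

text \<open>The tilt with \<beta> = 0: the two \<open>b\<close> terms cancel and the sum reduces to
  the total weight.\<close>

lemma has_bochner_integral_mix_density:
  assumes "\<gamma> \<in> mix_params m"
    and "\<And>k. k \<in> {1..ncomp \<gamma>} \<Longrightarrow> has_bochner_integral dy
      (\<lambda>y. exp (prec \<gamma> k * y * comp_theta \<theta> \<eta> m \<gamma> k x + c y (prec \<gamma> k)))
      (exp (prec \<gamma> k * b (comp_theta \<theta> \<eta> m \<gamma> k x)))"
  shows "has_bochner_integral dy (mix_density b c \<theta> \<eta> m \<gamma> x) 1"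
proof -
  have "\<And>k. k \<in> {1..ncomp \<gamma>} \<Longrightarrow> 0 < prec \<gamma> k" "(\<Sum>k=1..ncomp \<gamma>. weight \<gamma> k) = 1"
    using assms(1) by (auto simp: mix_params_def PiE_iff)
  then show ?thesis
    using has_bochner_integral_mix_density_tilt[of \<gamma> dy \<theta> \<eta> m x 0 c b] assms(2) by simp
qed

text \<open>Writing \<open>1 / p\<close> as \<open>1 + exp (- h) * exp (- \<beta> * y)\<close>
  splits the integral into the total mass of the density and \<open>exp (- h)\<close> times the
  tilted integral; \<open>g_fun\<close> is the quantity that merges this last product into one
  exponential.\<close>

lemma integral_mix_density_inverse_response:
  assumes \<gamma>: "\<gamma> \<in> mix_params m"
    and int0: "\<And>k. k \<in> {1..ncomp \<gamma>} \<Longrightarrow> has_bochner_integral dy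
      (\<lambda>y. exp (prec \<gamma> k * y * comp_theta \<theta> \<eta> m \<gamma> k x + c y (prec \<gamma> k)))
      (exp (prec \<gamma> k * b (comp_theta \<theta> \<eta> m \<gamma> k x)))"
    and int1: "\<And>k. k \<in> {1..ncomp \<gamma>} \<Longrightarrow> has_bochner_integral dy
      (\<lambda>y. exp (prec \<gamma> k * y * (comp_theta \<theta> \<eta> m \<gamma> k x - \<beta> / prec \<gamma> k) + c y (prec \<gamma> k)))
      (exp (prec \<gamma> k * b (comp_theta \<theta> \<eta> m \<gamma> k x - \<beta> / prec \<gamma> k)))"
    and p: "\<And>y. 0 < p y \<and> p y < 1 \<and> logit (p y) = h x \<alpha> + \<beta> * y"
  shows "(\<integral>y. mix_density b c \<theta> \<eta> m \<gamma> x y * inverse (p y) \<partial>dy) =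
    1 + exp (- g_fun h b \<theta> \<eta> m \<alpha> \<beta> \<gamma> x)"
proof -
  let ?f = "mix_density b c \<theta> \<eta> m \<gamma> x"
  let ?S = "\<Sum>k=1..ncomp \<gamma>. weight \<gamma> k * exp (- prec \<gamma> k * b (comp_theta \<theta> \<eta> m \<gamma> k x)
       + prec \<gamma> k * b (comp_theta \<theta> \<eta> m \<gamma> k x - \<beta> / prec \<gamma> k))"
  have "\<And>k. k \<in> {1..ncomp \<gamma>} \<Longrightarrow> 0 < prec \<gamma> k"
    using \<gamma> by (auto simp: mix_params_def PiE_iff)
  then have "has_bochner_integral dy (\<lambda>y. ?f y * exp (- \<beta> * y)) ?S"
    using int1 by (rule has_bochner_integral_mix_density_tilt)
  then have "has_bochner_integral dy
      (\<lambda>y. ?f y + exp (- h x \<alpha>) * (?f y * exp (- \<beta> * y))) (1 + exp (- h x \<alpha>) * ?S)"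
    using has_bochner_integral_mix_density[OF \<gamma> int0]
    by (intro has_bochner_integral_add has_bochner_integral_mult_right)
  moreover have "?f y + exp (- h x \<alpha>) * (?f y * exp (- \<beta> * y)) = ?f y * inverse (p y)" for y
  proof -
    have "inverse (p y) = 1 + exp (- h x \<alpha>) * exp (- \<beta> * y)"
      using p[of y] inverse_eq_if_logit_eq[of "p y"] by (simp add: exp_add [symmetric])
    then show ?thesis
      by (simp only: distrib_left mult_1_right mult.left_commute)
  qed
  moreover have "exp (- h x \<alpha>) * ?S = exp (- g_fun h b \<theta> \<eta> m \<alpha> \<beta> \<gamma> x)"
  proof -
    have "0 < ?S"
      using \<gamma> by (rule mix_params_weighted_sum_pos) simp
    then have "exp (ln ?S) = ?S"
      by (rule exp_ln)
    then show ?thesis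
      by (simp only: g_fun_def minus_diff_eq diff_conv_add_uminus exp_add minus_add_distrib
          minus_minus)
  qed
  ultimately show ?thesis
    by (simp only: has_bochner_integral_integral_eq)
qed

text \<open>Both functions have total mass one, so integrating the equation gives
  \<open>1 / d = 1 / e\<close>. As \<open>d\<close> is positive, this forces \<open>e = d\<close>
  even under the convention \<open>1 / 0 = 0\<close>, and the common factor cancels.\<close>

lemma scaled_densities_AE_eq:
  fixes p q :: "'b \<Rightarrow> real"
  assumes "has_bochner_integral M p 1" "has_bochner_integral M q 1"
    and "AE y in M. p y / d = q y / e" "0 < d"
  shows "d = e" "AE y in M. p y = q y"
proof -
  have [measurable]: "p \<in> borel_measurable M" "q \<in> borel_measurable M"
    using assms(1,2) by (auto dest: borel_measurable_has_bochner_integral)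
  have "(\<integral>y. p y / d \<partial>M) = (\<integral>y. q y / e \<partial>M)"
    using assms(3) by (intro integral_cong_AE) auto
  then have "1 / d = 1 / e"
    using assms(1,2) by (simp add: has_bochner_integral_integral_eq)
  then show "d = e"
    using assms(4) by simp
  then show "AE y in M. p y = q y"
    using assms(3,4) by (auto elim!: eventually_mono)
qed

theorem theorem2:
  fixes PX :: "'x::euclidean_space measure"
    and dy :: "real measure"
    and A :: "'a::euclidean_space set" and B :: "real set" and \<Gamma> :: "mix_param set"
    and h :: "'x \<Rightarrow> 'a \<Rightarrow> real"
    and b :: "real \<Rightarrow> real" and c :: "real \<Rightarrow> real \<Rightarrow> real" and \<theta> :: "real \<Rightarrow> real"
    and \<eta> :: "nat \<Rightarrow> nat \<Rightarrow> 'x \<Rightarrow> real" and m :: "nat \<Rightarrow> nat"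
    and P :: "'a \<Rightarrow> real \<Rightarrow> 'x \<Rightarrow> real \<Rightarrow> real"
    and f :: "'a \<Rightarrow> real \<Rightarrow> mix_param \<Rightarrow> 'x \<Rightarrow> real \<Rightarrow> real"
  assumes PX: "prob_space PX" "sets PX = sets borel"
    and dy: "(\<lambda>y. y) \<in> borel_measurable dy"
    and \<Gamma>: "\<Gamma> \<subseteq> mix_params m"
    and h_inj: "\<And>\<alpha> \<alpha>'. \<alpha> \<in> A \<Longrightarrow> \<alpha>' \<in> A \<Longrightarrow> (AE x in PX. h x \<alpha> = h x \<alpha>') \<Longrightarrow> \<alpha> = \<alpha>'"
    and b_normalizing:
      "\<And>\<beta> \<gamma> k. \<beta> \<in> B \<Longrightarrow> \<gamma> \<in> \<Gamma> \<Longrightarrow> k \<in> {1..ncomp \<gamma>} \<Longrightarrow>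
         AE x in PX. \<forall>t \<in> {comp_theta \<theta> \<eta> m \<gamma> k x, comp_theta \<theta> \<eta> m \<gamma> k x - \<beta> / prec \<gamma> k}.
           has_bochner_integral dy (\<lambda>y. exp (prec \<gamma> k * y * t + c y (prec \<gamma> k))) (exp (prec \<gamma> k * b t))"
    and response:
      "\<And>\<alpha> \<beta> x y. \<alpha> \<in> A \<Longrightarrow> \<beta> \<in> B \<Longrightarrow>
         0 < P \<alpha> \<beta> x y \<and> P \<alpha> \<beta> x y < 1 \<and> logit (P \<alpha> \<beta> x y) = h x \<alpha> + \<beta> * y"
    and bayes:
      "\<And>\<alpha> \<beta> \<gamma> x y. \<alpha> \<in> A \<Longrightarrow> \<beta> \<in> B \<Longrightarrow> \<gamma> \<in> \<Gamma> \<Longrightarrow>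
         P \<alpha> \<beta> x y * f \<alpha> \<beta> \<gamma> x y =
           mix_density b c \<theta> \<eta> m \<gamma> x y /
           (\<integral>u. mix_density b c \<theta> \<eta> m \<gamma> x u * inverse (P \<alpha> \<beta> x u) \<partial>dy)"
    and respondents_identifiable: "identifiable PX dy \<Gamma> (mix_density b c \<theta> \<eta> m)"
  shows "identifiable PX dy (A \<times> B \<times> \<Gamma>) (\<lambda>(\<alpha>, \<beta>, \<gamma>) x y. P \<alpha> \<beta> x y * f \<alpha> \<beta> \<gamma> x y) \<longleftrightarrow>
    (\<forall>\<alpha>\<in>A. \<forall>\<alpha>'\<in>A. \<forall>\<beta>\<in>B. \<forall>\<beta>'\<in>B. \<forall>\<gamma>\<in>\<Gamma>.
       (AE x in PX. g_fun h b \<theta> \<eta> m \<alpha> \<beta> \<gamma> x = g_fun h b \<theta> \<eta> m \<alpha>' \<beta>' \<gamma> x) \<longrightarrow> \<beta> = \<beta>')"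
proof -
  let ?q = "\<lambda>\<alpha> \<beta> \<gamma> x y. P \<alpha> \<beta> x y * f \<alpha> \<beta> \<gamma> x y"
  let ?d = "mix_density b c \<theta> \<eta> m"
  let ?g = "g_fun h b \<theta> \<eta> m"
  \<comment> \<open>The exceptional null set may depend on the parameters. This is harmless, since
    only two parameter triples are ever compared at a time.\<close>
  have likelihood: "AE x in PX. has_bochner_integral dy (?d \<gamma> x) 1 \<and>
      (\<forall>y. ?q \<alpha> \<beta> \<gamma> x y = ?d \<gamma> x y / (1 + exp (- ?g \<alpha> \<beta> \<gamma> x)))"
    if "\<alpha> \<in> A" "\<beta> \<in> B" "\<gamma> \<in> \<Gamma>" for \<alpha> \<beta> \<gamma>
  proof -
    have "AE x in PX. \<forall>k\<in>{1..ncomp \<gamma>}.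
        \<forall>t \<in> {comp_theta \<theta> \<eta> m \<gamma> k x, comp_theta \<theta> \<eta> m \<gamma> k x - \<beta> / prec \<gamma> k}.
          has_bochner_integral dy (\<lambda>y. exp (prec \<gamma> k * y * t + c y (prec \<gamma> k)))
            (exp (prec \<gamma> k * b t))"
      \<comment> \<open>One null set per component; there are finitely many components.\<close>
      using b_normalizing that by (intro AE_finite_allI) auto
    then show ?thesis
    proof (rule eventually_mono)
      fix x
      assume int: "\<forall>k\<in>{1..ncomp \<gamma>}.
        \<forall>t \<in> {comp_theta \<theta> \<eta> m \<gamma> k x, comp_theta \<theta> \<eta> m \<gamma> k x - \<beta> / prec \<gamma> k}.
          has_bochner_integral dy (\<lambda>y. exp (prec \<gamma> k * y * t + c y (prec \<gamma> k)))
            (exp (prec \<gamma> k * b t))"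
      have \<gamma>: "\<gamma> \<in> mix_params m"
        using \<Gamma> that by auto
      have "has_bochner_integral dy (?d \<gamma> x) 1"
        using int by (intro has_bochner_integral_mix_density[OF \<gamma>]) auto
      moreover have "(\<integral>u. ?d \<gamma> x u * inverse (P \<alpha> \<beta> x u) \<partial>dy) = 1 + exp (- ?g \<alpha> \<beta> \<gamma> x)"
        using int response that
        by (intro integral_mix_density_inverse_response[OF \<gamma>]) auto
      ultimately show "has_bochner_integral dy (?d \<gamma> x) 1 \<and>
          (\<forall>y. ?q \<alpha> \<beta> \<gamma> x y = ?d \<gamma> x y / (1 + exp (- ?g \<alpha> \<beta> \<gamma> x)))"
        using bayes that by simp
    qed
  qed
  show ?thesis
  proof
    assume ident: "identifiable PX dy (A \<times> B \<times> \<Gamma>) (\<lambda>(\<alpha>, \<beta>, \<gamma>). ?q \<alpha> \<beta> \<gamma>)"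
    show "\<forall>\<alpha>\<in>A. \<forall>\<alpha>'\<in>A. \<forall>\<beta>\<in>B. \<forall>\<beta>'\<in>B. \<forall>\<gamma>\<in>\<Gamma>.
       (AE x in PX. ?g \<alpha> \<beta> \<gamma> x = ?g \<alpha>' \<beta>' \<gamma> x) \<longrightarrow> \<beta> = \<beta>'"
    proof (intro ballI impI)
      fix \<alpha> \<alpha>' \<beta> \<beta>' \<gamma>
      assume par: "\<alpha> \<in> A" "\<alpha>' \<in> A" "\<beta> \<in> B" "\<beta>' \<in> B" "\<gamma> \<in> \<Gamma>"
        and eq: "AE x in PX. ?g \<alpha> \<beta> \<gamma> x = ?g \<alpha>' \<beta>' \<gamma> x"
      \<comment> \<open>With the same \<gamma> on both sides the numerators agree, and equal
        \<open>g\<close> makes the denominators agree.\<close>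
      have "AE x in PX. AE y in dy. ?q \<alpha> \<beta> \<gamma> x y = ?q \<alpha>' \<beta>' \<gamma> x y"
        using likelihood[OF par(1,3,5)] likelihood[OF par(2,4,5)] eq
        by eventually_elim simp
      then have "(\<alpha>, \<beta>, \<gamma>) = (\<alpha>', \<beta>', \<gamma>)"
        using ident par unfolding identifiable_def by fastforce
      then show "\<beta> = \<beta>'"
        by simp
    qed
  next
    assume g_inj: "\<forall>\<alpha>\<in>A. \<forall>\<alpha>'\<in>A. \<forall>\<beta>\<in>B. \<forall>\<beta>'\<in>B. \<forall>\<gamma>\<in>\<Gamma>.
       (AE x in PX. ?g \<alpha> \<beta> \<gamma> x = ?g \<alpha>' \<beta>' \<gamma> x) \<longrightarrow> \<beta> = \<beta>'"
    have "\<alpha> = \<alpha>' \<and> \<beta> = \<beta>' \<and> \<gamma> = \<gamma>'"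
      if par: "\<alpha> \<in> A" "\<alpha>' \<in> A" "\<beta> \<in> B" "\<beta>' \<in> B" "\<gamma> \<in> \<Gamma>" "\<gamma>' \<in> \<Gamma>"
        and eq: "AE x in PX. AE y in dy. ?q \<alpha> \<beta> \<gamma> x y = ?q \<alpha>' \<beta>' \<gamma>' x y"
      for \<alpha> \<alpha>' \<beta> \<beta>' \<gamma> \<gamma>'
    proof -
      \<comment> \<open>For fixed \<open>x\<close> the denominators are constants in
        \<open>y\<close>, so each likelihood is a rescaled probability density and its total mass
        reveals the scale.\<close>
      have recovered: "AE x in PX. ?g \<alpha> \<beta> \<gamma> x = ?g \<alpha>' \<beta>' \<gamma>' x \<and>
          (AE y in dy. ?d \<gamma> x y = ?d \<gamma>' x y)"
        using likelihood[OF par(1,3,5)] likelihood[OF par(2,4,6)] eq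
      proof eventually_elim
        case (elim x)
        then have "AE y in dy. ?d \<gamma> x y / (1 + exp (- ?g \<alpha> \<beta> \<gamma> x)) =
            ?d \<gamma>' x y / (1 + exp (- ?g \<alpha>' \<beta>' \<gamma>' x))"
          by simp
        moreover have "0 < 1 + exp (- ?g \<alpha> \<beta> \<gamma> x)"
          by (simp add: add_pos_pos)
        ultimately have "1 + exp (- ?g \<alpha> \<beta> \<gamma> x) = 1 + exp (- ?g \<alpha>' \<beta>' \<gamma>' x)"
            "AE y in dy. ?d \<gamma> x y = ?d \<gamma>' x y"
          by (rule scaled_densities_AE_eq[OF conjunct1[OF elim(1)] conjunct1[OF elim(2)]])+
        then show ?case
          by simp
      qed
      then have "AE x in PX. AE y in dy. ?d \<gamma> x y = ?d \<gamma>' x y"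
        by (auto elim: eventually_mono)
      then have \<gamma>: "\<gamma> = \<gamma>'"
        using respondents_identifiable par unfolding identifiable_def by blast
      \<comment> \<open>Both sides now carry the same \<gamma>, which is the form that the condition
        on \<open>g\<close> requires.\<close>
      have g: "AE x in PX. ?g \<alpha> \<beta> \<gamma> x = ?g \<alpha>' \<beta>' \<gamma> x"
        using recovered \<gamma> by (auto elim: eventually_mono)
      then have \<beta>: "\<beta> = \<beta>'"
        using g_inj par by blast
      \<comment> \<open>The logarithmic term of \<open>g\<close> depends only on \<beta>, \<gamma>
        and \<open>x\<close>, so it cancels.\<close>
      have "AE x in PX. h x \<alpha> = h x \<alpha>'"
        using g unfolding \<beta> by (auto simp: g_fun_def)
      then show ?thesis
        using h_inj par \<beta> \<gamma> by blast
    qed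
    then show "identifiable PX dy (A \<times> B \<times> \<Gamma>) (\<lambda>(\<alpha>, \<beta>, \<gamma>). ?q \<alpha> \<beta> \<gamma>)"
      unfolding identifiable_def by fastforce
  qed
qed

end
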